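(* Let $n$ be a non-negative integer and let $q,a,k$ be non-zero complex numbers, with fixed square roots $\sqrt a,\sqrt k,\sqrt q$, and set $\sqrt{kq}=\sqrt k\sqrt q$, $\sqrt{q/k}=\sqrt q/\sqrt k$. Then each of the following two identities holds whenever no denominator on either side of it vanishes: $${}_{10}\phi_9\left[\begin{matrix} a,\ q\sqrt a,\ -q\sqrt a,\ a\sqrt{q/k},\ -a\sqrt{q/k},\ aq/\sqrt k,\ -aq/\sqrt k,\ k/(aq),\ kq^n,\ q^{-n}\\ \sqrt a,\ -\sqrt a,\ \sqrt{kq},\ -\sqrt{kq},\ \sqrt k,\ -\sqrt k,\ a^2q^2/k,\ aq^{-n+1}/k,\ aq^{n+1}\end{matrix};q,q\right]=\frac{(aq,\ k^2/(a^2q);q)_n}{(k,\ k/a;q)_n}$$ and $${}_{10}\phi_9\left[\begin{matrix} a,\ q\sqrt a,\ -q\sqrt a,\ a\sqrt{q/k},\ -a\sqrt{q/k},\ a/\sqrt k,\ -aq/\sqrt k,\ k/a,\ kq^n,\ q^{-n}\\ \sqrt a,\ -\sqrt a,\ \sqrt{kq},\ -\sqrt{kq},\ q\sqrt k,\ -\sqrt k,\ a^2q/k,\ aq^{-n+1}/k,\ aq^{n+1}\end{matrix};q,q\right]=\frac{(aq,\ \sqrt k,\ k^2/a^2;q)_n}{(k,\ k/a,\ q\sqrt k;q)_n} .$$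
   Context: For complex $a,q$ and a non-negative integer $n$, $(a;q)_n:=\prod_{k=0}^{n-1}(1-aq^k)$, with $(a;q)_0=1$, and $(a_1,\ldots,a_m;q)_n:=\prod_{i=1}^m (a_i;q)_n$. The unilateral basic hypergeometric series is $${}_{r+1}\phi_r\left[\begin{matrix} a_0,\ldots,a_r\\ b_1,\ldots,b_r\end{matrix};q,z\right]:=\sum_{j=0}^{\infty}\frac{(a_0,\ldots,a_r;q)_j}{(q,b_1,\ldots,b_r;q)_j}z^j .$$ When one numerator parameter is $q^{-n}$ the series terminates and is read as the finite sum over $0\le j\le n$ (so no convergence condition on $z$ is needed). *)

theory Defs
  imports Complex_Main
begin

definition qpoch :: "complex \<Rightarrow> complex \<Rightarrow> nat \<Rightarrow> complex" where
  "qpoch a q n = (\<Prod>k<n. 1 - a * q ^ k)"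

definition qpochs :: "complex list \<Rightarrow> complex \<Rightarrow> nat \<Rightarrow> complex" where
  "qpochs xs q n = (\<Prod>a\<leftarrow>xs. qpoch a q n)"

text \<open>The numerator parameters \<open>a\<^sub>0, \<dots>, a\<^sub>r\<close> are the list \<open>xs\<close> and the denominator
  parameters \<open>b\<^sub>1, \<dots>, b\<^sub>r\<close> are the list \<open>ys\<close>, so \<open>xs\<close> is one element longer than \<open>ys\<close>.
  The extra denominator factor \<open>(q; q)\<^sub>j\<close> is not listed in \<open>ys\<close>.\<close>

definition qhyp_coeff :: "complex list \<Rightarrow> complex list \<Rightarrow> complex \<Rightarrow> nat \<Rightarrow> complex" where
  "qhyp_coeff xs ys q j = qpochs xs q j / qpochs (q # ys) q j"

definition qhyp :: "complex list \<Rightarrow> complex list \<Rightarrow> complex \<Rightarrow> complex \<Rightarrow> complex" where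
  "qhyp xs ys q z = (\<Sum>j. qhyp_coeff xs ys q j * z ^ j)"

text \<open>The reading of the series when some numerator parameter is \<open>q\<^sup>-\<^sup>n\<close>: the sum over
  \<open>0 \<le> j \<le> n\<close>, for which only the denominators with \<open>j \<le> n\<close> matter.\<close>

definition qhyp_terminating ::
    "nat \<Rightarrow> complex list \<Rightarrow> complex list \<Rightarrow> complex \<Rightarrow> complex \<Rightarrow> complex" where
  "qhyp_terminating n xs ys q z = (\<Sum>j\<le>n. qhyp_coeff xs ys q j * z ^ j)"

definition qhyp_denominators_nonzero :: "nat \<Rightarrow> complex list \<Rightarrow> complex \<Rightarrow> bool" where
  "qhyp_denominators_nonzero n ys q \<longleftrightarrow> (\<forall>j\<le>n. qpochs (q # ys) q j \<noteq> 0)"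

lemma qhyp_eq_qhyp_terminating:
  assumes "q \<noteq> 0" and "q powi (- int n) \<in> set xs"
  shows "qhyp xs ys q z = qhyp_terminating n xs ys q z"
proof -
  have "qhyp_coeff xs ys q j = 0" if "j \<notin> {..n}" for j
  proof -
    have "q powi (- int n) * q ^ n = 1"
      using assms(1) by (simp add: power_int_minus)
    with that have "qpoch (q powi (- int n)) q j = 0"
      unfolding qpoch_def by (auto intro!: bexI[of _ n])
    with assms(2) have "qpochs xs q j = 0"
      unfolding qpochs_def by (force simp: prod_list_zero_iff)
    then show ?thesis
      by (simp add: qhyp_coeff_def)
  qed
  then show ?thesis
    unfolding qhyp_def qhyp_terminating_def by (intro suminf_finite) auto
qed

end

theory Submission
  imports Defs
begin

text \<open>
Write \<open>M(n, j; a, k) = (k)\<^sub>n\<^sub>+\<^sub>j (k/a)\<^sub>n\<^sub>-\<^sub>j / ((q)\<^sub>n\<^sub>-\<^sub>j (aq)\<^sub>n\<^sub>+\<^sub>j)\<close> for the kernel of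
well-poised (WP) Bailey pairs relative to \<open>a\<close> and \<open>k\<close>. Two classical facts carry the proof.

First, for every \<open>m\<close> there is an explicit very-well-poised sequence \<open>\<alpha>\<^sub>j\<close>, depending on \<open>a\<close> and \<open>m\<close>,
with \<open>\<Sum>\<^sub>j M(r, j; a, m) \<alpha>\<^sub>j = [r = 0]\<close> (\<open>unit_pair_sum\<close>); the partial sums have a closed form with
a factor that vanishes at the upper end. Secondly, the kernel for \<open>k\<close> is a weighted sum of kernels
for another parameter \<open>m\<close>: there are weights \<open>w\<^sub>r\<close> and factors \<open>\<delta>\<^sub>j\<close> with
\<open>\<Sum>\<^sub>r w\<^sub>r M(r, j; a, m) = \<delta>\<^sub>j (k/m)\<^sup>j M(n, j; a, k)\<close>. Multiplying by \<open>\<alpha>\<^sub>j\<close>, summing over \<open>j\<close> and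
exchanging the sums leaves \<open>w\<^sub>0\<close> on the left, so that
\<open>\<Sum>\<^sub>j \<delta>\<^sub>j (k/m)\<^sup>j M(n, j; a, k) \<alpha>\<^sub>j = w\<^sub>0\<close>. Up to a factor that does not depend on \<open>j\<close>, the summand here
is that of the terminating \<open>\<^sub>1\<^sub>0\<phi>\<^sub>9\<close>, and \<open>w\<^sub>0\<close> gives its value (\<open>vwp_sum_by_insertion\<close>).

The first identity is the case \<open>m = a\<^sup>2q/k\<close>, \<open>\<delta>\<^sub>j = (m)\<^sub>2\<^sub>j/(k)\<^sub>2\<^sub>j\<close>; the sum over \<open>r\<close> is then the
q-Pfaff-Saalschuetz sum (\<open>q_saalschuetz\<close>). The second is the case \<open>m = a\<^sup>2/k\<close>, where the weights acquire
the factor \<open>1 + (a/\<surd>k) q\<^sup>r\<close>; since \<open>m\<close> is the square of \<open>a/\<surd>k\<close>, the sum over \<open>r\<close> is again summable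
(\<open>weighted_saalschuetz\<close>). Both of these sums satisfy a first-order recurrence in the upper limit, which
is proved by telescoping.

This argument divides by \<open>(aq)\<^sub>2\<^sub>n\<close>, by \<open>1 - a\<close> and, for the second identity, by \<open>1 + a/\<surd>k\<close>. These may
vanish although all denominators of the identities are non-zero: for instance \<open>aq = 1\<close> is possible,
because \<open>(aq)\<^sub>n\<close> occurs only as a factor on the right, and the series has \<open>(aq\<^sup>n\<^sup>+\<^sup>1)\<^sub>j\<close> below the line. For fixed \<open>q\<close> and \<open>k\<close> only
finitely many \<open>a\<close> are lost, both sides are continuous in \<open>a\<close>, and the identities extend to these points.
\<close>

section \<open>Finite q-shifted factorials\<close>

lemma qpoch_0 [simp]: "qpoch a q 0 = 1"
  by (simp add: qpoch_def)

lemma qpoch_Suc: "qpoch a q (Suc n) = qpoch a q n * (1 - a * q ^ n)"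
  by (simp add: qpoch_def)

lemma qpoch_add: "qpoch a q (m + n) = qpoch a q m * qpoch (a * q ^ m) q n"
  by (induction n) (simp_all add: qpoch_Suc power_add algebra_simps)

lemma qpoch_Suc_left: "qpoch a q (Suc n) = (1 - a) * qpoch (a * q) q n"
  using qpoch_add[of a q 1 n] by (simp add: qpoch_Suc)

lemma qpoch_nonzero_mono:
  assumes "qpoch a q n \<noteq> 0" and "m \<le> n"
  shows "qpoch a q m \<noteq> 0"
  using assms qpoch_add[of a q m "n - m"] by auto

lemma qpoch_nonzero_factor:
  assumes "qpoch a q n \<noteq> 0" and "m < n"
  shows "a * q ^ m \<noteq> 1"
  using qpoch_nonzero_mono[OF assms(1), of "Suc m"] assms(2) by (auto simp: qpoch_Suc)

lemma qpoch_mult_uminus: "qpoch x q n * qpoch (- x) q n = qpoch (x ^ 2) (q ^ 2) n"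
  by (induction n) (simp_all add: qpoch_Suc power2_eq_square power_mult_distrib algebra_simps)

lemma qpoch_double: "qpoch x q (2 * n) = qpoch x (q ^ 2) n * qpoch (x * q) (q ^ 2) n"
proof (induction n)
  case (Suc n)
  have "qpoch x q (2 * Suc n) = qpoch x q (2 * n) * (1 - x * q ^ (2 * n)) * (1 - x * q * q ^ (2 * n))"
    by (simp add: qpoch_Suc mult.assoc)
  then show ?case by (simp add: Suc qpoch_Suc power_mult)
qed simp

section \<open>The q-Pfaff-Saalschuetz sum\<close>

text \<open>The summand of the balanced \<open>\<^sub>3\<phi>\<^sub>2\<close> with numerator parameters \<open>A\<close>, \<open>B\<close>, \<open>q\<^sup>-\<^sup>N\<close>, cleared of the
denominators \<open>(ABC)\<^sub>t\<close>. With \<open>C\<close> as the third parameter (the usual lower parameter is \<open>c = ABC\<close>), it is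
polynomial in \<open>A\<close>, \<open>B\<close> and \<open>C\<close>, and the sum is symmetric in the roles of \<open>A\<close> and \<open>B\<close>.\<close>

definition saalschuetz_term :: "complex \<Rightarrow> complex \<Rightarrow> complex \<Rightarrow> complex \<Rightarrow> nat \<Rightarrow> nat \<Rightarrow> complex" where
  "saalschuetz_term A B C q N t = qpoch A q t * qpoch B q t * qpoch C q (N - t) *
     qpoch (A * B * C * q ^ t) q (N - t) * C ^ t / (qpoch q q t * qpoch q q (N - t))"

text \<open>The sums \<open>S\<^sub>N\<close> should satisfy \<open>(1 - q\<^sup>N\<^sup>+\<^sup>1) S\<^sub>N\<^sub>+\<^sub>1 = (1 - ACq\<^sup>N) (1 - BCq\<^sup>N) S\<^sub>N\<close>. The right-hand side below
is the antidifference in \<open>t\<close> of the difference of the two summands (a q-Gosper certificate).\<close>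

lemma saalschuetz_partial_sum:
  assumes nz: "qpoch q q (Suc N) \<noteq> 0" and "J \<le> N"
  shows "(\<Sum>t\<le>J. (1 - q ^ Suc N) * saalschuetz_term A B C q (Suc N) t
             - (1 - A * C * q ^ N) * (1 - B * C * q ^ N) * saalschuetz_term A B C q N t)
         = - C * q ^ (N - J) * (1 - A * q ^ J) * (1 - B * q ^ J) * saalschuetz_term A B C q N J"
  using assms(2)
proof (induction J)
  case 0
  have "qpoch q q N \<noteq> 0" "1 - q * q ^ N \<noteq> 0"
    using nz by (auto simp: qpoch_Suc)
  then show ?case
    by (simp add: saalschuetz_term_def qpoch_Suc field_simps)
next
  case (Suc J)
  then obtain d where N: "N = J + 1 + d"
    by (metis Suc_eq_plus1 le_Suc_ex)
  define x y where "x = q ^ J" and "y = q ^ d"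
  define X where "X = qpoch A q J * qpoch B q J * qpoch C q d * qpoch (A * B * C * q ^ Suc J) q d * C ^ J
     / (qpoch q q J * qpoch q q d)"
  have "qpoch q q (J + 1) \<noteq> 0" "qpoch q q (Suc (Suc d)) \<noteq> 0"
    by (rule qpoch_nonzero_mono[OF nz]; simp add: N)+
  then have nz': "qpoch q q J \<noteq> 0" "qpoch q q d \<noteq> 0" "1 - q * x \<noteq> 0" "1 - q * y \<noteq> 0" "1 - q * (q * y) \<noteq> 0"
    by (auto simp: qpoch_Suc x_def y_def)
  have 1: "saalschuetz_term A B C q N J = X * (1 - C * y) * (1 - A * B * C * x) / (1 - q * y)"
  proof -
    have "qpoch (A * B * C * q ^ J) q (Suc d) = (1 - A * B * C * x) * qpoch (A * B * C * q ^ Suc J) q d"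
      by (simp add: qpoch_Suc_left x_def mult_ac)
    then show ?thesis
      by (simp add: saalschuetz_term_def N X_def qpoch_Suc y_def mult_ac)
  qed
  have 2: "saalschuetz_term A B C q N (Suc J) = X * (1 - A * x) * (1 - B * x) * C / (1 - q * x)"
    by (simp add: saalschuetz_term_def N X_def qpoch_Suc x_def mult_ac)
  have 3: "saalschuetz_term A B C q (Suc N) (Suc J) = X * (1 - A * x) * (1 - B * x) * C / (1 - q * x)
     * (1 - C * y) * (1 - A * B * C * q * x * y) / (1 - q * y)"
    by (simp add: saalschuetz_term_def N X_def qpoch_Suc x_def y_def mult_ac)
  have pw: "q ^ N = q * x * y" "q ^ (N - J) = q * y" "q ^ (N - Suc J) = y" "q ^ Suc J = q * x"
    by (simp_all add: N x_def y_def power_add)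
  have IH: "(\<Sum>t\<le>J. (1 - q ^ Suc N) * saalschuetz_term A B C q (Suc N) t
             - (1 - A * C * q ^ N) * (1 - B * C * q ^ N) * saalschuetz_term A B C q N t)
         = - C * (q * y) * (1 - A * x) * (1 - B * x) * saalschuetz_term A B C q N J"
    using Suc by (simp add: pw x_def)
  have "- C * (q * y) * (1 - A * x) * (1 - B * x) * (X * (1 - C * y) * (1 - A * B * C * x) / (1 - q * y))
     + ((1 - q * (q * x * y)) * (X * (1 - A * x) * (1 - B * x) * C / (1 - q * x)
     * (1 - C * y) * (1 - A * B * C * q * x * y) / (1 - q * y)) - (1 - A * C * (q * x * y)) * (1 - B * C * (q * x * y)) *
       (X * (1 - A * x) * (1 - B * x) * C / (1 - q * x)))
     = - C * y * (1 - A * (q * x)) * (1 - B * (q * x)) * (X * (1 - A * x) * (1 - B * x) * C / (1 - q * x))"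
    using nz'(3,4) by (simp add: divide_simps) algebra
  then show ?case
    unfolding sum.atMost_Suc IH unfolding 1 2 3 power_Suc[of q N] pw by simp
qed

text \<open>At \<open>J = N\<close> the partial sum cancels against the one remaining term \<open>t = N + 1\<close> of the longer sum,
which leaves the recurrence in \<open>N\<close>.\<close>

theorem q_saalschuetz:
  assumes "qpoch q q N \<noteq> 0"
  shows "(\<Sum>t\<le>N. saalschuetz_term A B C q N t) = qpoch (A * C) q N * qpoch (B * C) q N / qpoch q q N"
  using assms
proof (induction N)
  case 0
  then show ?case by (simp add: saalschuetz_term_def)
next
  case (Suc N)
  have nz: "qpoch q q N \<noteq> 0" "1 - q * q ^ N \<noteq> 0"
    using Suc.prems by (auto simp: qpoch_Suc)
  let ?S = "\<lambda>N. \<Sum>t\<le>N. saalschuetz_term A B C q N t"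
  have top: "(1 - q ^ Suc N) * saalschuetz_term A B C q (Suc N) (Suc N) = C * (1 - A * q ^ N) * (1 - B * q ^ N) * saalschuetz_term A B C q N N"
    using nz by (simp add: saalschuetz_term_def qpoch_Suc field_simps)
  have "(1 - q ^ Suc N) * (\<Sum>t\<le>N. saalschuetz_term A B C q (Suc N) t) - (1 - A * C * q ^ N) * (1 - B * C * q ^ N) * ?S N
      = - C * (1 - A * q ^ N) * (1 - B * q ^ N) * saalschuetz_term A B C q N N"
    using saalschuetz_partial_sum[OF Suc.prems, of N A B C] by (simp add: sum_subtractf sum_distrib_left)
  then have "(1 - q ^ Suc N) * ?S (Suc N) = (1 - A * C * q ^ N) * (1 - B * C * q ^ N) * ?S N"
    unfolding sum.atMost_Suc distrib_left top by (simp add: algebra_simps)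
  also have "\<dots> = (1 - q ^ Suc N) * (qpoch (A * C) q (Suc N) * qpoch (B * C) q (Suc N) / qpoch q q (Suc N))"
    using nz by (simp add: Suc.IH qpoch_Suc)
  finally show ?case
    by (subst (asm) mult_left_cancel) (use nz in auto)
qed

section \<open>A summable contiguous sum\<close>

text \<open>The term of the balanced sum with \<open>A = \<sigma>\<^sup>2\<close>, \<open>B = 1/E\<close> and \<open>C = E\<^sup>2\<close>, except that the lower parameter is
\<open>ABCq\<close> instead of \<open>ABC\<close>. The sum is thus off balance by one power of \<open>q\<close>, and the weight \<open>1 + \<sigma>q\<^sup>t\<close>
restores summability thanks to \<open>A = \<sigma>\<^sup>2\<close> and \<open>C = B\<^sup>-\<^sup>2\<close>.\<close>

definition weighted_term :: "complex \<Rightarrow> complex \<Rightarrow> complex \<Rightarrow> nat \<Rightarrow> nat \<Rightarrow> complex" where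
  "weighted_term \<sigma> E q N t = qpoch (\<sigma> ^ 2) q t * qpoch (1 / E) q t * qpoch (E ^ 2) q (N - t) *
     qpoch (\<sigma> ^ 2 * E * q * q ^ t) q (N - t) * (E ^ 2) ^ t / (qpoch q q t * qpoch q q (N - t))"

text \<open>The telescoping step of the next lemma after cancelling the common factor of its terms, with
\<open>u = q\<^sup>J\<^sup>+\<^sup>1\<close> and \<open>y = q\<^sup>N\<^sup>-\<^sup>J\<^sup>-\<^sup>1\<close>.\<close>

lemma weighted_certificate:
  fixes \<sigma> E q u y :: complex
  shows "(u * y * \<sigma> * (q - E) * (1 - q * y * E) + (E - 1) * (\<sigma> ^ 2 * q * (u * y) * (u * y) * E - q * y))
          * (1 - E ^ 2 * y) * (1 - \<sigma> ^ 2 * E * u) * (1 - u)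
        + (E - 1) * ((1 + \<sigma> * u) * ((1 - q * (u * y)) * (1 - \<sigma> * E * (u * y)) * (1 - E ^ 2 * y) * (1 - \<sigma> ^ 2 * E * q * (u * y))
            - (1 - \<sigma> ^ 2 * E ^ 2 * (u * y)) * (1 - E * (u * y)) * (1 - \<sigma> * E * (q * (u * y))) * (1 - q * y)))
      = E * (E - u) * (1 - \<sigma> ^ 2 * u) *
           (u * y * \<sigma> * (q - E) * (1 - y * E)
             + (E - 1) * (\<sigma> ^ 2 * q * (u * y) * (u * y) * E - y)) * (1 - q * y)"
  by (simp add: algebra_simps power2_eq_square)

text \<open>The q-Gosper certificate for the recurrence of the weighted sum. The long factor on the right is
\<open>c\<^sub>0 + c\<^sub>1 q\<^sup>-\<^sup>J\<close> with \<open>c\<^sub>0\<close> and \<open>c\<^sub>1\<close> free of \<open>J\<close>; comparing powers of \<open>q\<^sup>J\<close> determines them up to the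
denominator \<open>E - 1\<close>, hence the factor \<open>E - 1\<close> on the left.\<close>

lemma weighted_partial_sum:
  assumes nz: "qpoch q q (Suc N) \<noteq> 0" and E: "E \<noteq> 0" and "J \<le> N"
  shows "(E - 1) * (\<Sum>t\<le>J. (1 + \<sigma> * q ^ t) *
             ((1 - q ^ Suc N) * (1 - \<sigma> * E * q ^ N) * weighted_term \<sigma> E q (Suc N) t
             - (1 - \<sigma> ^ 2 * E ^ 2 * q ^ N) * (1 - E * q ^ N) * (1 - \<sigma> * E * q ^ Suc N) * weighted_term \<sigma> E q N t))
         = E * (E - q ^ J) * (1 - \<sigma> ^ 2 * q ^ J) *
           (q ^ N * \<sigma> * (q - E) * (1 - q ^ (N - J) * E)
             + (E - 1) * (\<sigma> ^ 2 * q * q ^ N * q ^ N * E - q ^ (N - J))) * weighted_term \<sigma> E q N J"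
  using assms(3)
proof (induction J)
  case 0
  define y where "y = q ^ N"
  have nz': "qpoch q q N \<noteq> 0" "1 - q * y \<noteq> 0"
    using nz by (auto simp: qpoch_Suc y_def)
  define X where "X = weighted_term \<sigma> E q N 0"
  have "weighted_term \<sigma> E q (Suc N) 0 = X * (1 - E ^ 2 * y) * (1 - \<sigma> ^ 2 * E * q * y) / (1 - q * y)"
    using nz' by (simp add: weighted_term_def qpoch_Suc X_def y_def)
  then have 1: "(1 - q * y) * (1 - \<sigma> * E * y) * weighted_term \<sigma> E q (Suc N) 0
    = (1 - \<sigma> * E * y) * (X * (1 - E ^ 2 * y) * (1 - \<sigma> ^ 2 * E * q * y))"
    using nz' by (simp add: y_def)
  have "(E - 1) * ((1 + \<sigma>) * ((1 - \<sigma> * E * y) * (X * (1 - E ^ 2 * y) * (1 - \<sigma> ^ 2 * E * q * y))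
     - (1 - \<sigma> ^ 2 * E ^ 2 * y) * (1 - E * y) * (1 - \<sigma> * E * (q * y)) * X))
     = E * (E - 1) * (1 - \<sigma> ^ 2) * (y * \<sigma> * (q - E) * (1 - y * E)
             + (E - 1) * (\<sigma> ^ 2 * q * y * y * E - y)) * X"
    by algebra
  then show ?case
    by (simp add: 1 flip: y_def X_def)
next
  case (Suc J)
  then obtain d where N: "N = J + 1 + d"
    by (metis Suc_eq_plus1 le_Suc_ex)
  define x y where "x = q ^ J" and "y = q ^ d"
  define X where "X = qpoch (\<sigma> ^ 2) q J * qpoch (1 / E) q J * qpoch (E ^ 2) q d *
     qpoch (\<sigma> ^ 2 * E * q * q ^ Suc J) q d * (E ^ 2) ^ J / (qpoch q q J * qpoch q q d)"
  have "qpoch q q (J + 1) \<noteq> 0" "qpoch q q (Suc (Suc d)) \<noteq> 0"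
    by (rule qpoch_nonzero_mono[OF nz]; simp add: N)+
  then have nz': "qpoch q q J \<noteq> 0" "qpoch q q d \<noteq> 0" "1 - q * x \<noteq> 0" "1 - q * y \<noteq> 0" "1 - q * (q * y) \<noteq> 0"
    by (auto simp: qpoch_Suc x_def y_def)
  have 1: "weighted_term \<sigma> E q N J = X * (1 - E ^ 2 * y) * (1 - \<sigma> ^ 2 * E * q * x) / (1 - q * y)"
  proof -
    have "qpoch (\<sigma> ^ 2 * E * q * q ^ J) q (Suc d) = (1 - \<sigma> ^ 2 * E * q * x) * qpoch (\<sigma> ^ 2 * E * q * q ^ Suc J) q d"
      by (simp add: qpoch_Suc_left x_def mult_ac)
    then show ?thesis
      by (simp add: weighted_term_def N X_def qpoch_Suc y_def mult_ac)
  qed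
  have 2: "weighted_term \<sigma> E q N (Suc J) = X * (1 - \<sigma> ^ 2 * x) * (E - x) * E / (1 - q * x)"
  proof -
    have "E ^ 2 * (1 - q ^ J / E) = E * (E - q ^ J)"
      using E by (simp add: field_simps power2_eq_square)
    then show ?thesis
      by (simp add: weighted_term_def N X_def qpoch_Suc x_def mult_ac)
  qed
  have 3: "weighted_term \<sigma> E q (Suc N) (Suc J) = weighted_term \<sigma> E q N (Suc J) * (1 - E ^ 2 * y) * (1 - \<sigma> ^ 2 * E * q * (q * x * y)) / (1 - q * y)"
    by (simp add: weighted_term_def N qpoch_Suc x_def y_def power_add mult_ac)
  have pw: "q ^ N = q * x * y" "q ^ (N - J) = q * y" "q ^ (N - Suc J) = y" "q ^ Suc J = q * x"
    by (simp_all add: N x_def y_def power_add)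
  have IH: "(E - 1) * (\<Sum>t\<le>J. (1 + \<sigma> * q ^ t) *
             ((1 - q ^ Suc N) * (1 - \<sigma> * E * q ^ N) * weighted_term \<sigma> E q (Suc N) t
             - (1 - \<sigma> ^ 2 * E ^ 2 * q ^ N) * (1 - E * q ^ N) * (1 - \<sigma> * E * q ^ Suc N) * weighted_term \<sigma> E q N t))
         = E * (E - x) * (1 - \<sigma> ^ 2 * x) *
           (q ^ N * \<sigma> * (q - E) * (1 - q * y * E)
             + (E - 1) * (\<sigma> ^ 2 * q * q ^ N * q ^ N * E - q * y)) * weighted_term \<sigma> E q N J"
    using Suc by (simp add: pw x_def)
  let ?Q = "q * x * y"
  have "E * (E - x) * (1 - \<sigma> ^ 2 * x) *
           (?Q * \<sigma> * (q - E) * (1 - q * y * E)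
             + (E - 1) * (\<sigma> ^ 2 * q * ?Q * ?Q * E - q * y)) *
        (X * (1 - E ^ 2 * y) * (1 - \<sigma> ^ 2 * E * q * x) / (1 - q * y))
     + (E - 1) * ((1 + \<sigma> * (q * x)) * ((1 - q * ?Q) * (1 - \<sigma> * E * ?Q) *
          (X * (1 - \<sigma> ^ 2 * x) * (E - x) * E / (1 - q * x) * (1 - E ^ 2 * y) * (1 - \<sigma> ^ 2 * E * q * ?Q) / (1 - q * y))
             - (1 - \<sigma> ^ 2 * E ^ 2 * ?Q) * (1 - E * ?Q) * (1 - \<sigma> * E * (q * ?Q)) *
          (X * (1 - \<sigma> ^ 2 * x) * (E - x) * E / (1 - q * x))))
     = E * (E - q * x) * (1 - \<sigma> ^ 2 * (q * x)) *
           (?Q * \<sigma> * (q - E) * (1 - y * E)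
             + (E - 1) * (\<sigma> ^ 2 * q * ?Q * ?Q * E - y)) * (X * (1 - \<sigma> ^ 2 * x) * (E - x) * E / (1 - q * x))"
  proof -
    define u v where "u = 1 - q * x" and "v = 1 - q * y"
    have uv: "u \<noteq> 0" "v \<noteq> 0" using nz' by (simp_all add: u_def v_def)
    have clear: "F * P * (X * a * b / v) + e * (c * (l1 * l2 * (X * f1 * f2 * f3 / u * a * g / v) - r * (X * f1 * f2 * f3 / u)))
        = R * (X * f1 * f2 * f3 / u)"
      if "F = f3 * f2 * f1" "P * a * b * u + e * (c * (l1 * l2 * a * g - r * v)) = R * v"
      for F P a b e c l1 l2 f1 f2 f3 g r R :: complex
    proof -
      have "F * P * (X * a * b / v) + e * (c * (l1 * l2 * (X * f1 * f2 * f3 / u * a * g / v) - r * (X * f1 * f2 * f3 / u)))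
        = X * F / (u * v) * (P * a * b * u + e * (c * (l1 * l2 * a * g - r * v)))"
        using uv by (simp add: that(1) divide_simps) (simp add: algebra_simps)
      also have "\<dots> = R * (X * f1 * f2 * f3 / u)"
        unfolding that(2) using uv by (simp add: that(1))
      finally show ?thesis .
    qed
    show ?thesis
      unfolding u_def[symmetric] v_def[symmetric]
    proof (rule clear)
      show "E * (E - x) * (1 - \<sigma> ^ 2 * x) = E * (E - x) * (1 - \<sigma> ^ 2 * x)" ..
    qed (use weighted_certificate[of "q * x" y \<sigma> q E] in \<open>simp only: mult.assoc u_def v_def\<close>)
  qed
  then show ?case
    unfolding sum.atMost_Suc distrib_left[of "E - 1"] IH unfolding 3 1 2 power_Suc[of q N] pw by simp
qed

text \<open>The value is written with \<open>(\<sigma>Eq)\<^sub>N/(\<sigma>E)\<^sub>N\<close>, which equals \<open>(1 - \<sigma>Eq\<^sup>N)/(1 - \<sigma>E)\<close> but is also right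
for \<open>N = 0\<close>, \<open>\<sigma>E = 1\<close>.\<close>

theorem weighted_saalschuetz:
  assumes "qpoch q q N \<noteq> 0" and "qpoch (\<sigma> * E) q N \<noteq> 0" and E: "E \<noteq> 0"
  shows "(\<Sum>t\<le>N. (1 + \<sigma> * q ^ t) * weighted_term \<sigma> E q N t)
    = (1 + \<sigma>) * qpoch (\<sigma> ^ 2 * E ^ 2) q N * qpoch E q N * qpoch (\<sigma> * E * q) q N / (qpoch (\<sigma> * E) q N * qpoch q q N)"
proof (cases "E = 1")
  case True
  \<comment> \<open>The certificate reads \<open>0 = 0\<close> here, but for \<open>N > 0\<close> every term contains a factor \<open>(1)\<^sub>t\<close> with \<open>t > 0\<close>
    or the factor \<open>(1)\<^sub>N\<close>.\<close>
  then have vanish: "qpoch E q (Suc n) = 0" for n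
    by (simp add: qpoch_Suc_left)
  show ?thesis
  proof (cases N)
    case 0
    then show ?thesis by (simp add: weighted_term_def)
  next
    case (Suc M)
    have "weighted_term \<sigma> E q N t = 0" for t
      using True vanish by (cases t) (simp_all add: weighted_term_def Suc)
    then show ?thesis using vanish by (simp add: Suc)
  qed
next
  case False
  show ?thesis using assms(1,2)
  proof (induction N)
    case 0
    then show ?case by (simp add: weighted_term_def)
  next
    case (Suc N)
    define Q where "Q = q ^ N"
    have nz: "qpoch q q N \<noteq> 0" "1 - q * Q \<noteq> 0" "qpoch (\<sigma> * E) q N \<noteq> 0" "1 - \<sigma> * E * Q \<noteq> 0"
      using Suc.prems by (auto simp: qpoch_Suc Q_def)
    let ?S = "\<lambda>N. \<Sum>t\<le>N. (1 + \<sigma> * q ^ t) * weighted_term \<sigma> E q N t"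
    have top: "(1 - q * Q) * weighted_term \<sigma> E q (Suc N) (Suc N) = (1 - \<sigma> ^ 2 * Q) * ((E - Q) * E) * weighted_term \<sigma> E q N N"
    proof -
      have "(1 - Q / E) * E ^ 2 = (E - Q) * E"
        using E by (simp add: field_simps power2_eq_square)
      then show ?thesis
        using nz by (simp add: weighted_term_def qpoch_Suc mult_ac flip: Q_def)
    qed
    let ?L = "(1 - q * Q) * (1 - \<sigma> * E * Q)"
    let ?R = "(1 - \<sigma> ^ 2 * E ^ 2 * Q) * (1 - E * Q) * (1 - \<sigma> * E * (q * Q))"
    let ?s = "\<Sum>t\<le>N. (1 + \<sigma> * q ^ t) * weighted_term \<sigma> E q (Suc N) t"
    have "(E - 1) * (?L * ?s - ?R * ?S N)
        = E * (E - Q) * (1 - \<sigma> ^ 2 * Q) *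
           (Q * \<sigma> * (q - E) * (1 - E)
             + (E - 1) * (\<sigma> ^ 2 * q * Q * Q * E - 1)) * weighted_term \<sigma> E q N N"
      using weighted_partial_sum[OF Suc.prems(1) E, of N \<sigma>]
      by (simp add: sum_subtractf sum_distrib_left right_diff_distrib mult_ac flip: Q_def)
    also have "\<dots> = - (E - 1) * ((1 - \<sigma> * E * Q) * (1 + \<sigma> * q * Q) * ((1 - \<sigma> ^ 2 * Q) * ((E - Q) * E) * weighted_term \<sigma> E q N N))"
      by algebra
    also have "\<dots> = - (E - 1) * (?L * ((1 + \<sigma> * q ^ Suc N) * weighted_term \<sigma> E q (Suc N) (Suc N)))"
      unfolding top[symmetric] by (simp add: Q_def mult_ac)
    finally have "(E - 1) * (?L * ?S (Suc N)) = (E - 1) * (?R * ?S N)"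
      unfolding sum.atMost_Suc by (simp add: algebra_simps)
    then have "?L * ?S (Suc N) = ?R * ?S N"
      using False by simp
    also have "\<dots> = ?L * ((1 + \<sigma>) * qpoch (\<sigma> ^ 2 * E ^ 2) q (Suc N) * qpoch E q (Suc N) * qpoch (\<sigma> * E * q) q (Suc N) / (qpoch (\<sigma> * E) q (Suc N) * qpoch q q (Suc N)))"
      unfolding Suc.IH[OF nz(1,3)] using nz by (simp add: qpoch_Suc mult_ac flip: Q_def)
    finally show ?case
      by (subst (asm) mult_left_cancel) (use nz in auto)
  qed
qed

section \<open>The unit WP Bailey pair and insertion\<close>

text \<open>A sequence \<open>\<beta>\<close> with \<open>\<beta>\<^sub>n = \<Sum>\<^sub>j\<^sub>\<le>\<^sub>n M(n, j; a, k) \<alpha>\<^sub>j\<close> forms a WP Bailey pair with \<open>\<alpha>\<close>.\<close>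

definition wp_kernel :: "complex \<Rightarrow> complex \<Rightarrow> complex \<Rightarrow> nat \<Rightarrow> nat \<Rightarrow> complex" where
  "wp_kernel q a k n j = qpoch k q (n + j) * qpoch (k / a) q (n - j) / (qpoch q q (n - j) * qpoch (a * q) q (n + j))"

text \<open>The sequence \<open>\<alpha>\<close> whose partner \<open>\<beta>\<close> is \<open>1, 0, 0, \<dots>\<close>.\<close>

definition unit_alpha :: "complex \<Rightarrow> complex \<Rightarrow> complex \<Rightarrow> nat \<Rightarrow> complex" where
  "unit_alpha q a k j = (1 - a * q ^ (2 * j)) / (1 - a) * qpoch a q j * qpoch (a / k) q j
     / (qpoch q q j * qpoch (k * q) q j) * (k / a) ^ j"

text \<open>The sum is a very-well-poised \<open>\<^sub>6\<phi>\<^sub>5\<close> whose free parameters \<open>a/k\<close>, \<open>kq\<^sup>r\<close>, \<open>q\<^sup>-\<^sup>r\<close> have product \<open>a\<close>; such a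
sum is indefinitely summable. The factor \<open>1 - q\<^sup>r\<^sup>-\<^sup>J\<close> makes the full sum \<open>J = r\<close> vanish.\<close>

lemma unit_pair_partial_sum:
  assumes nz: "qpoch q q r \<noteq> 0" "qpoch (a * q) q (2 * r) \<noteq> 0" "qpoch (k * q) q r \<noteq> 0"
    and [simp]: "a \<noteq> 0" "a \<noteq> 1" "k \<noteq> 0" and "J \<le> r"
  shows "(1 - k * q ^ r) * (1 - q ^ r) * (\<Sum>j\<le>J. wp_kernel q a k r j * unit_alpha q a k j)
     = qpoch k q (r + J + 1) * qpoch (k / a) q (r - J) * (1 - q ^ (r - J)) / (qpoch q q (r - J) * qpoch (a * q) q (r + J))
       * (qpoch (a * q) q J * qpoch (a * q / k) q J / (qpoch q q J * qpoch (k * q) q J)) * (k / a) ^ J"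
  using assms(7)
proof (induction J)
  case 0
  then show ?case
    by (simp add: wp_kernel_def unit_alpha_def qpoch_Suc)
next
  case (Suc J)
  then obtain d where r: "r = J + 1 + d"
    by (metis Suc_eq_plus1 le_Suc_ex)
  define x y where "x = q ^ J" and "y = q ^ d"
  define X where "X = qpoch k q (r + J + 1) * qpoch (k / a) q d / (qpoch q q d * qpoch (a * q) q (r + J))
       * (qpoch (a * q) q J * qpoch (a * q / k) q J / (qpoch q q J * qpoch (k * q) q J)) * (k / a) ^ J"
  have "qpoch q q (Suc J) \<noteq> 0" "qpoch q q (Suc d) \<noteq> 0"
    "qpoch (k * q) q (Suc J) \<noteq> 0" "qpoch (a * q) q (Suc (r + J)) \<noteq> 0"
    by (rule qpoch_nonzero_mono[OF nz(1)] qpoch_nonzero_mono[OF nz(2)] qpoch_nonzero_mono[OF nz(3)]; simp add: r)+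
  then have nz': "qpoch q q J \<noteq> 0" "qpoch q q d \<noteq> 0" "1 - q * x \<noteq> 0" "1 - q * y \<noteq> 0"
    "qpoch (k * q) q J \<noteq> 0" "1 - k * q * x \<noteq> 0"
    "qpoch (a * q) q (r + J) \<noteq> 0" "1 - a * q * (q * x * y) * x \<noteq> 0"
    by (auto simp: qpoch_Suc r x_def y_def power_add mult_ac)
  have pw: "q ^ (r - J) = q * y" "q ^ (r - Suc J) = y" "q ^ r = q * x * y"
    by (simp_all add: r x_def y_def power_add)
  have 0: "qpoch k q (r + J + 1) * qpoch (k / a) q (r - J) * (1 - q ^ (r - J)) / (qpoch q q (r - J) * qpoch (a * q) q (r + J))
       * (qpoch (a * q) q J * qpoch (a * q / k) q J / (qpoch q q J * qpoch (k * q) q J)) * (k / a) ^ J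
     = X * (1 - k / a * y)"
  proof -
    have "r - J = Suc d" by (simp add: r)
    then show ?thesis
      using nz' by (simp add: qpoch_Suc X_def pw y_def)
  qed
  have 1: "qpoch k q (r + Suc J + 1) * qpoch (k / a) q (r - Suc J) * (1 - q ^ (r - Suc J)) / (qpoch q q (r - Suc J) * qpoch (a * q) q (r + Suc J))
       * (qpoch (a * q) q (Suc J) * qpoch (a * q / k) q (Suc J) / (qpoch q q (Suc J) * qpoch (k * q) q (Suc J))) * (k / a) ^ Suc J
     = X * (1 - k * (q * x) * (q * x * y)) * (1 - y) / (1 - a * q * (q * x * y) * x) *
        ((1 - a * q * x) * (1 - a * q / k * x) / ((1 - q * x) * (1 - k * q * x)) * (k / a))"
  proof -
    have "r - Suc J = d" by (simp add: r)
    moreover have "qpoch k q (r + Suc J + 1) = qpoch k q (r + J + 1) * (1 - k * (q * x) * (q * x * y))"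
    proof -
      have "r + Suc J + 1 = Suc (r + J + 1)" "q ^ (r + J + 1) = (q * x) * (q * x * y)"
        using pw(3) by (simp_all add: power_add x_def mult_ac)
      then show ?thesis
        by (simp only: qpoch_Suc mult.assoc)
    qed
    moreover have "qpoch (a * q) q (r + Suc J) = qpoch (a * q) q (r + J) * (1 - a * q * (q * x * y) * x)"
      by (simp add: qpoch_Suc x_def y_def r power_add mult_ac)
    ultimately show ?thesis
      by (simp add: qpoch_Suc[of _ _ J] X_def pw flip: x_def y_def) (simp add: mult_ac)
  qed
  have 2: "wp_kernel q a k r (Suc J) * unit_alpha q a k (Suc J) =
      X * (1 - a * (q * x) ^ 2) * ((1 - a / k) * (k / a)) / ((1 - q * x) * (1 - k * q * x) * (1 - a * q * (q * x * y) * x))"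
  proof -
    have "r - Suc J = d" by (simp add: r)
    moreover have "qpoch (a * q) q (r + Suc J) = qpoch (a * q) q (r + J) * (1 - a * q * (q * x * y) * x)"
      by (simp add: qpoch_Suc x_def y_def r power_add mult_ac)
    moreover have "q ^ (2 * Suc J) = (q * x) ^ 2"
      by (simp add: x_def power2_eq_square power_add mult_2 mult_2_right mult_ac)
    moreover have "r + Suc J = r + J + 1" by simp
    ultimately show ?thesis
      unfolding wp_kernel_def unit_alpha_def X_def qpoch_Suc_left[of a] qpoch_Suc_left[of "a / k"] qpoch_Suc[of q q J] qpoch_Suc[of "k * q" q J]
      using \<open>a \<noteq> 1\<close> by (simp add: x_def mult_ac)
  qed
  have 3: "(1 - k * (q * x * y)) * (1 - q * x * y) * (1 - a * (q * x) ^ 2) * ((1 - a / k) * (k / a)) +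
    (1 - k / a * y) * ((1 - q * x) * (1 - k * q * x) * (1 - a * q * (q * x * y) * x))
   = (1 - k * (q * x) * (q * x * y)) * (1 - y) * (1 - a * q * x) * ((1 - a * q / k * x) * (k / a))"
  proof -
    define p where "p = k / a"
    have k: "k = p * a" and "p \<noteq> 0" by (simp_all add: p_def)
    then have e: "(1 - a / k) * (k / a) = p - 1" "(1 - a * q / k * x) * (k / a) = p - q * x"
      by (simp_all add: field_simps)
    show ?thesis unfolding e unfolding p_def[symmetric] unfolding k by algebra
  qed
  have "(1 - k * q ^ r) * (1 - q ^ r) * (wp_kernel q a k r (Suc J) * unit_alpha q a k (Suc J)) + X * (1 - k / a * y)
    = X * (1 - k * (q * x) * (q * x * y)) * (1 - y) / (1 - a * q * (q * x * y) * x) *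
        ((1 - a * q * x) * (1 - a * q / k * x) / ((1 - q * x) * (1 - k * q * x)) * (k / a))"
  proof -
    define u where "u = (1 - q * x) * (1 - k * q * x) * (1 - a * q * (q * x * y) * x)"
    have "u \<noteq> 0" using nz' by (simp add: u_def)
    then have b: "X * (1 - k / a * y) = X / u * ((1 - k / a * y) * u)" by simp
    have a: "(1 - k * q ^ r) * (1 - q ^ r) * (wp_kernel q a k r (Suc J) * unit_alpha q a k (Suc J))
       = X / u * ((1 - k * (q * x * y)) * (1 - q * x * y) * (1 - a * (q * x) ^ 2) * ((1 - a / k) * (k / a)))"
      unfolding 2 pw u_def by (simp only: divide_inverse mult_ac)
    have c: "X * (1 - k * (q * x) * (q * x * y)) * (1 - y) / (1 - a * q * (q * x * y) * x) *
        ((1 - a * q * x) * (1 - a * q / k * x) / ((1 - q * x) * (1 - k * q * x)) * (k / a))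
       = X / u * ((1 - k * (q * x) * (q * x * y)) * (1 - y) * (1 - a * q * x) * ((1 - a * q / k * x) * (k / a)))"
      unfolding u_def by (simp only: times_divide_eq_left times_divide_eq_right divide_divide_eq_left mult_ac)
    show ?thesis
      unfolding a b c distrib_left[symmetric] using 3 by (simp only: u_def)
  qed
  then show ?case
    unfolding sum.atMost_Suc distrib_left 1 using Suc 0 by (simp add: add.commute)
qed

lemma unit_pair_sum:
  assumes nz: "qpoch q q r \<noteq> 0" "qpoch (a * q) q (2 * r) \<noteq> 0" "qpoch (k * q) q r \<noteq> 0"
    and "a \<noteq> 0" "a \<noteq> 1" "k \<noteq> 0"
  shows "(\<Sum>j\<le>r. wp_kernel q a k r j * unit_alpha q a k j) = (if r = 0 then 1 else 0)"
proof (cases r)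
  case 0
  then show ?thesis using assms by (simp add: wp_kernel_def unit_alpha_def)
next
  case (Suc s)
  have "k * q * q ^ s \<noteq> 1" "q * q ^ s \<noteq> 1"
    using qpoch_nonzero_factor[OF nz(3), of s] qpoch_nonzero_factor[OF nz(1), of s] by (simp_all add: Suc)
  then have "k * q ^ r \<noteq> 1" "q ^ r \<noteq> 1"
    by (simp_all add: Suc mult.assoc)
  moreover have "(1 - k * q ^ r) * (1 - q ^ r) * (\<Sum>j\<le>r. wp_kernel q a k r j * unit_alpha q a k j) = 0"
    unfolding unit_pair_partial_sum[OF assms order.refl] by simp
  ultimately show ?thesis
    using Suc by (simp only: mult_eq_0_iff right_minus_eq) auto
qed

text \<open>Exchanging the order of summation: the inner sums over \<open>j\<close> are those of the unit pair and only
\<open>r = 0\<close> survives.\<close>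

lemma bailey_insertion:
  assumes nz: "qpoch q q n \<noteq> 0" "qpoch (a * q) q (2 * n) \<noteq> 0" "qpoch (m * q) q n \<noteq> 0"
    and ne: "a \<noteq> 0" "a \<noteq> 1" "m \<noteq> 0"
    and K: "\<And>j. j \<le> n \<Longrightarrow> (\<Sum>r=j..n. w r * wp_kernel q a m r j) = K j"
  shows "(\<Sum>j\<le>n. K j * unit_alpha q a m j) = w 0"
proof -
  let ?f = "\<lambda>r j. w r * (wp_kernel q a m r j * unit_alpha q a m j)"
  have "(\<Sum>j\<le>n. K j * unit_alpha q a m j) = (\<Sum>j\<le>n. \<Sum>r | r \<in> {..n} \<and> j \<le> r. ?f r j)"
  proof (rule sum.cong[OF refl])
    fix j assume "j \<in> {..n}"
    moreover have "{r. r \<in> {..n} \<and> j \<le> r} = {j..n}" by auto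
    ultimately show "K j * unit_alpha q a m j = (\<Sum>r | r \<in> {..n} \<and> j \<le> r. ?f r j)"
      by (simp add: K[symmetric] sum_distrib_right mult.assoc)
  qed
  also have "\<dots> = (\<Sum>r\<le>n. \<Sum>j | j \<in> {..n} \<and> j \<le> r. ?f r j)"
    by (rule sum.swap_restrict) auto
  also have "\<dots> = (\<Sum>r\<le>n. w r * (if r = 0 then 1 else 0))"
  proof (rule sum.cong[OF refl])
    fix r assume r: "r \<in> {..n}"
    then have "{j. j \<in> {..n} \<and> j \<le> r} = {..r}" by auto
    moreover from r have "(\<Sum>j\<le>r. wp_kernel q a m r j * unit_alpha q a m j) = (if r = 0 then 1 else 0)"
      by (intro unit_pair_sum ne qpoch_nonzero_mono[OF nz(1)] qpoch_nonzero_mono[OF nz(2)] qpoch_nonzero_mono[OF nz(3)]) auto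
    ultimately show "(\<Sum>j | j \<in> {..n} \<and> j \<le> r. ?f r j) = w r * (if r = 0 then 1 else 0)"
      by (simp only: sum_distrib_left[symmetric])
  qed
  also have "\<dots> = w 0"
    by (simp add: if_distrib sum.delta cong: if_cong)
  finally show ?thesis .
qed

section \<open>Terminating very-well-poised sums as insertions\<close>

text \<open>Reversing the factors, \<open>(q\<^sup>1\<^sup>-\<^sup>n/y)\<^sub>j\<close> is \<open>(y)\<^sub>n / ((y)\<^sub>n\<^sub>-\<^sub>j y\<^sup>j)\<close> times a sign and a power of \<open>q\<close>. What matters
is that this constant does not depend on \<open>y\<close>: it cancels in the quotient of the cases \<open>y = q\<close> and
\<open>y = k/a\<close>.\<close>

lemma qpoch_reversal:
  assumes q: "q \<noteq> 0" and "j \<le> n"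
  shows "\<exists>c. c \<noteq> 0 \<and> (\<forall>y. y \<noteq> 0 \<longrightarrow>
    qpoch (q powi (1 - int n) / y) q j * qpoch y q (n - j) * y ^ j = c * qpoch y q n)"
  using assms(2)
proof (induction j)
  case 0
  show ?case by (intro exI[of _ 1]) simp
next
  case (Suc j)
  then obtain c where c: "c \<noteq> 0" and eq: "\<And>y. y \<noteq> 0 \<Longrightarrow>
     qpoch (q powi (1 - int n) / y) q j * qpoch y q (n - j) * y ^ j = c * qpoch y q n"
    by auto
  obtain d where n: "n = Suc j + d"
    using Suc.prems le_Suc_ex by blast
  \<comment> \<open>so \<open>1 - z/y = -(z/y) (1 - y q\<^sup>d)\<close> for the new factor, where \<open>z = q\<^sup>1\<^sup>-\<^sup>n\<^sup>+\<^sup>j\<close>\<close>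
  have z: "q powi (1 - int n) * q ^ j * q ^ d = 1"
    using q by (simp add: n power_int_diff field_simps flip: power_int_of_nat power_int_add)
  show ?case
  proof (intro exI[of _ "- (q powi (1 - int n) * q ^ j) * c"] conjI allI impI)
    show "- (q powi (1 - int n) * q ^ j) * c \<noteq> 0" using c q by simp
    fix y :: complex assume y: "y \<noteq> 0"
    let ?z = "q powi (1 - int n) * q ^ j"
    have e: "(1 - ?z / y) * y = - ?z * (1 - y * q ^ d)"
      using y z by (simp add: field_simps)
    have "qpoch (q powi (1 - int n) / y) q (Suc j) * qpoch y q (n - Suc j) * y ^ Suc j
       = qpoch (q powi (1 - int n) / y) q j * qpoch y q (n - Suc j) * y ^ j * ((1 - ?z / y) * y)"
      by (simp add: qpoch_Suc mult_ac)
    also have "\<dots> = - ?z * (qpoch (q powi (1 - int n) / y) q j * qpoch y q (Suc d) * y ^ j)"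
      unfolding e by (simp add: n qpoch_Suc mult_ac)
    also have "qpoch (q powi (1 - int n) / y) q j * qpoch y q (Suc d) * y ^ j = c * qpoch y q n"
      using eq[OF y] by (simp add: n)
    finally show "qpoch (q powi (1 - int n) / y) q (Suc j) * qpoch y q (n - Suc j) * y ^ Suc j
       = - (q powi (1 - int n) * q ^ j) * c * qpoch y q n"
      by simp
  qed
qed

text \<open>The four parameters of the series that involve \<open>n\<close> assemble into the kernel.\<close>

lemma wp_kernel_ratio:
  assumes "q \<noteq> 0" "a \<noteq> 0" "k \<noteq> 0" and j: "j \<le> n"
    and nz: "qpoch q q n \<noteq> 0" "qpoch (k / a) q n \<noteq> 0" "qpoch k q n \<noteq> 0" "qpoch (a * q) q (2 * n) \<noteq> 0"
  shows "qpoch (k * q ^ n) q j * qpoch (q powi (- int n)) q j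
       / (qpoch (a * q powi (- int n + 1) / k) q j * qpoch (a * q ^ (n + 1)) q j) * q ^ j
     = qpoch q q n * qpoch (a * q) q n / (qpoch k q n * qpoch (k / a) q n) * wp_kernel q a k n j * (k / a) ^ j"
proof -
  obtain c where c: "c \<noteq> 0" and eq: "\<And>y. y \<noteq> 0 \<Longrightarrow>
     qpoch (q powi (1 - int n) / y) q j * qpoch y q (n - j) * y ^ j = c * qpoch y q n"
    using qpoch_reversal[OF assms(1) j] by blast
  have p: "q powi (1 - int n) / q = q powi (- int n)"
    using assms(1) by (simp add: power_int_diff power_int_minus field_simps)
  have nz': "qpoch q q (n - j) \<noteq> 0" "qpoch (a * q) q n \<noteq> 0"
    "qpoch (a * q * q ^ n) q j \<noteq> 0"
    using qpoch_nonzero_mono[OF nz(1), of "n - j"] qpoch_nonzero_mono[OF nz(4), of "n + j"] j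
    by (auto simp: qpoch_add)
  have "qpoch (q powi (- int n)) q j * q ^ j = c * qpoch q q n / qpoch q q (n - j)"
    using eq[OF assms(1)] nz'(1) by (simp add: p field_simps)
  moreover have "1 / qpoch (a * q powi (- int n + 1) / k) q j = qpoch (k / a) q (n - j) * (k / a) ^ j / (c * qpoch (k / a) q n)"
  proof -
    have e: "qpoch (a * q powi (- int n + 1) / k) q j * (qpoch (k / a) q (n - j) * (k / a) ^ j) = c * qpoch (k / a) q n"
      using eq[of "k / a"] assms by (simp add: mult_ac add.commute)
    moreover have "c * qpoch (k / a) q n \<noteq> 0" using c nz by simp
    ultimately have "qpoch (k / a) q (n - j) * (k / a) ^ j \<noteq> 0" by (metis mult_zero_right)
    then show ?thesis unfolding e[symmetric] by (rule nonzero_divide_mult_cancel_right[symmetric])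
  qed
  ultimately have "qpoch (k * q ^ n) q j * (qpoch (q powi (- int n)) q j * q ^ j)
       * (1 / qpoch (a * q powi (- int n + 1) / k) q j) / qpoch (a * q ^ (n + 1)) q j
     = qpoch (k * q ^ n) q j * (c * qpoch q q n / qpoch q q (n - j))
       * (qpoch (k / a) q (n - j) * (k / a) ^ j / (c * qpoch (k / a) q n)) / qpoch (a * q ^ (n + 1)) q j"
    by simp
  also have "\<dots> = qpoch q q n * qpoch (a * q) q n / (qpoch k q n * qpoch (k / a) q n) * wp_kernel q a k n j * (k / a) ^ j"
    using nz nz' c by (simp add: wp_kernel_def qpoch_add divide_simps mult_ac)
  finally show ?thesis by (simp add: mult_ac)
qed

text \<open>The part common to the summands of both \<open>\<^sub>1\<^sub>0\<phi>\<^sub>9\<close> series: what remains after removing the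
parameters with square roots of \<open>k\<close>. The first quotient is \<open>(1 - aq\<^sup>2\<^sup>j)/(1 - a)\<close>, in the form that is
correct at \<open>j = 0\<close> for \<open>a = 1\<close> too.\<close>

definition vwp_term :: "complex \<Rightarrow> complex \<Rightarrow> complex \<Rightarrow> complex \<Rightarrow> nat \<Rightarrow> nat \<Rightarrow> complex" where
  "vwp_term q a k m n j = qpoch (a * q ^ 2) (q ^ 2) j / qpoch a (q ^ 2) j
     * (qpoch a q j * qpoch (a / m) q j / (qpoch q q j * qpoch (m * q) q j))
     * (qpoch (k * q ^ n) q j * qpoch (q powi (- int n)) q j
       / (qpoch (a * q powi (- int n + 1) / k) q j * qpoch (a * q ^ (n + 1)) q j) * q ^ j)"

lemma vwp_sum_by_insertion:
  assumes ne: "q \<noteq> 0" "a \<noteq> 0" "a \<noteq> 1" "m \<noteq> 0" "k \<noteq> 0"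
    and nz: "qpoch q q n \<noteq> 0" "qpoch (k / a) q n \<noteq> 0" "qpoch k q n \<noteq> 0" "qpoch (a * q) q (2 * n) \<noteq> 0"
      "qpoch (m * q) q n \<noteq> 0" "qpoch a (q ^ 2) n \<noteq> 0"
    and K: "\<And>j. j \<le> n \<Longrightarrow> (\<Sum>r=j..n. w r * wp_kernel q a m r j) = \<delta> j * (k / m) ^ j * wp_kernel q a k n j"
  shows "(\<Sum>j\<le>n. \<delta> j * vwp_term q a k m n j)
     = qpoch q q n * qpoch (a * q) q n / (qpoch k q n * qpoch (k / a) q n) * w 0"
proof -
  let ?P = "qpoch q q n * qpoch (a * q) q n / (qpoch k q n * qpoch (k / a) q n)"
  have "(\<Sum>j\<le>n. \<delta> j * vwp_term q a k m n j) = (\<Sum>j\<le>n. ?P * (\<delta> j * (k / m) ^ j * wp_kernel q a k n j * unit_alpha q a m j))"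
  proof (rule sum.cong[OF refl])
    fix j assume "j \<in> {..n}"
    then have j: "j \<le> n" by simp
    have "qpoch (a * q ^ 2) (q ^ 2) j / qpoch a (q ^ 2) j = (1 - a * q ^ (2 * j)) / (1 - a)"
      unfolding power_mult[of q 2 j] using qpoch_Suc[of a "q ^ 2" j] qpoch_nonzero_mono[OF nz(6) j] ne
      by (simp add: qpoch_Suc_left field_simps)
    moreover have "(k / a) ^ j = (k / m) ^ j * (m / a) ^ j"
      using ne by (simp flip: power_mult_distrib)
    ultimately show "\<delta> j * vwp_term q a k m n j = ?P * (\<delta> j * (k / m) ^ j * wp_kernel q a k n j * unit_alpha q a m j)"
      unfolding vwp_term_def wp_kernel_ratio[OF ne(1,2,5) j nz(1-4)] by (simp add: unit_alpha_def mult_ac)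
  qed
  also have "\<dots> = ?P * w 0"
    unfolding sum_distrib_left[symmetric]
    by (subst bailey_insertion[of q n a m w]) (use ne nz K in auto)
  finally show ?thesis .
qed

text \<open>With \<open>r = j + t\<close>, the kernel becomes a term of a balanced sum in \<open>t\<close> from \<open>0\<close> to \<open>n - j\<close>, with numerator
parameters \<open>mq\<^sup>2\<^sup>j\<close> and \<open>m/a\<close> and lower parameter \<open>aq\<^sup>2\<^sup>j\<^sup>+\<^sup>1\<close>.\<close>

lemma wp_kernel_shift:
  assumes j: "j \<le> n" and t: "t \<le> n - j" and nz: "qpoch (a * q) q (n + j) \<noteq> 0"
  shows "wp_kernel q a m (j + t) j = qpoch m q (2 * j) / qpoch (a * q) q (n + j) *
    (qpoch (m * q ^ (2 * j)) q t * qpoch (m / a) q t * qpoch (a * q * q ^ (2 * j) * q ^ t) q (n - j - t) / qpoch q q t)"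
proof -
  define d where "d = n - j - t"
  have n: "n = j + t + d" using j t by (simp add: d_def)
  have e: "n + j = 2 * j + t + d" "j + t + j = 2 * j + t" using n by simp_all
  have "qpoch (a * q) q (n + j) = qpoch (a * q) q (2 * j + t) * qpoch (a * q * q ^ (2 * j) * q ^ t) q d"
    unfolding e by (simp add: qpoch_add power_add mult.assoc)
  with nz show ?thesis
    unfolding wp_kernel_def e(2) d_def[symmetric] by (auto simp: qpoch_add mult_ac)
qed

lemma wp_kernel_split:
  assumes j: "j \<le> n"
  shows "wp_kernel q a k n j = qpoch k q (2 * j) / qpoch (a * q) q (n + j) *
    (qpoch (k * q ^ (2 * j)) q (n - j) * qpoch (k / a) q (n - j) / qpoch q q (n - j))"
proof -
  have "qpoch k q (n + j) = qpoch k q (2 * j) * qpoch (k * q ^ (2 * j)) q (n - j)"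
    using qpoch_add[of k q "2 * j" "n - j"] j by (simp add: add.commute)
  then show ?thesis
    unfolding wp_kernel_def by (simp add: mult_ac)
qed

lemma sum_from:
  fixes f :: "nat \<Rightarrow> complex"
  assumes "j \<le> n"
  shows "sum f {j..n} = (\<Sum>t\<le>n - j. f (j + t))"
  using sum.atLeastAtMost_shift_0[OF assms, of f] by (simp add: atLeast0AtMost)

section \<open>The two identities for generic a\<close>

text \<open>The weights are \<open>w\<^sub>r = C\<^sup>r (C)\<^sub>n\<^sub>-\<^sub>r/(q)\<^sub>n\<^sub>-\<^sub>r\<close> with \<open>C = k/m = k\<^sup>2/(a\<^sup>2q)\<close>. The choice \<open>m = a\<^sup>2q/k\<close> is forced by
balancing: \<open>(mq\<^sup>2\<^sup>j) (m/a) (k/m) = aq\<^sup>2\<^sup>j\<^sup>+\<^sup>1\<close>.\<close>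

lemma first_identity_generic:
  assumes ne: "q \<noteq> 0" "a \<noteq> 0" "a \<noteq> 1" "k \<noteq> 0"
    and nz: "qpoch q q n \<noteq> 0" "qpoch (k / a) q n \<noteq> 0" "qpoch k q (2 * n) \<noteq> 0" "qpoch (a * q) q (2 * n) \<noteq> 0"
      "qpoch (a ^ 2 * q / k * q) q n \<noteq> 0" "qpoch a (q ^ 2) n \<noteq> 0"
  shows "(\<Sum>j\<le>n. qpoch (a ^ 2 * q / k) q (2 * j) / qpoch k q (2 * j) * vwp_term q a k (a ^ 2 * q / k) n j)
     = qpoch (a * q) q n * qpoch (k ^ 2 / (a ^ 2 * q)) q n / (qpoch k q n * qpoch (k / a) q n)"
proof -
  define m where "m = a ^ 2 * q / k"
  define C where "C = k / m"
  define w where "w r = C ^ r * qpoch C q (n - r) / qpoch q q (n - r)" for r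
  have m: "m \<noteq> 0" using ne by (simp add: m_def)
  have C: "C = k ^ 2 / (a ^ 2 * q)" by (simp add: C_def m_def power2_eq_square)
  have eqs: "m * C = k" "m / a * C = k / a" "m * (m / a) * C = a * q"
    using ne m by (simp_all add: C_def) (simp add: m_def power2_eq_square)
  have "(\<Sum>j\<le>n. qpoch m q (2 * j) / qpoch k q (2 * j) * vwp_term q a k m n j)
    = qpoch q q n * qpoch (a * q) q n / (qpoch k q n * qpoch (k / a) q n) * w 0"
  proof (rule vwp_sum_by_insertion)
    show "qpoch k q n \<noteq> 0" by (rule qpoch_nonzero_mono[OF nz(3)]) simp
    show "qpoch (m * q) q n \<noteq> 0" using nz by (simp add: m_def)
    fix j assume j: "j \<le> n"
    have jn: "qpoch (a * q) q (n + j) \<noteq> 0" "qpoch k q (2 * j) \<noteq> 0" "qpoch q q (n - j) \<noteq> 0"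
      by (rule qpoch_nonzero_mono[OF nz(4)] qpoch_nonzero_mono[OF nz(3)] qpoch_nonzero_mono[OF nz(1)]; use j in simp)+
    let ?A = "m * q ^ (2 * j)"
    have "(\<Sum>r=j..n. w r * wp_kernel q a m r j)
      = (\<Sum>t\<le>n-j. C ^ j * (qpoch m q (2 * j) / qpoch (a * q) q (n + j)) * saalschuetz_term ?A (m / a) C q (n - j) t)"
      unfolding sum_from[OF j]
    proof (rule sum.cong[OF refl])
      fix t assume "t \<in> {..n - j}"
      then have t: "t \<le> n - j" by simp
      have "?A * (m / a) * C = a * q * q ^ (2 * j)"
        by (simp only: eqs(3)[symmetric] mult_ac)
      then show "w (j + t) * wp_kernel q a m (j + t) j = C ^ j * (qpoch m q (2 * j) / qpoch (a * q) q (n + j)) * saalschuetz_term ?A (m / a) C q (n - j) t"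
        unfolding wp_kernel_shift[OF j t jn(1)] saalschuetz_term_def w_def by (simp add: power_add mult_ac)
    qed
    also have "\<dots> = C ^ j * (qpoch m q (2 * j) / qpoch (a * q) q (n + j)) *
       (qpoch (k * q ^ (2 * j)) q (n - j) * qpoch (k / a) q (n - j) / qpoch q q (n - j))"
    proof -
      have e: "?A * C = k * q ^ (2 * j)" by (simp only: eqs(1)[symmetric] mult_ac)
      show ?thesis
        unfolding sum_distrib_left[symmetric] q_saalschuetz[OF jn(3)] eqs(2) e ..
    qed
    also have "\<dots> = qpoch m q (2 * j) / qpoch k q (2 * j) * (k / m) ^ j * wp_kernel q a k n j"
      unfolding wp_kernel_split[OF j] C_def using jn by simp
    finally show "(\<Sum>r=j..n. w r * wp_kernel q a m r j) = qpoch m q (2 * j) / qpoch k q (2 * j) * (k / m) ^ j * wp_kernel q a k n j" .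
  qed (use ne m nz in auto)
  then show ?thesis
    using nz by (simp add: w_def C flip: m_def)
qed

text \<open>Here \<open>m = a\<^sup>2/k\<close>, so that \<open>\<rho> = a/s\<close> is a square root of \<open>m\<close>, and the weights are those of the first
identity multiplied by \<open>(s)\<^sub>n/(sq)\<^sub>n \<cdot> (1 + \<rho>q\<^sup>r)/(1 + \<rho>)\<close>, with \<open>C = k/m = E\<^sup>2\<close> and \<open>E = k/a\<close>. The inner sum is the
weighted one for \<open>\<sigma> = \<rho>q\<^sup>j\<close>.\<close>

lemma second_identity_generic:
  assumes ne: "q \<noteq> 0" "a \<noteq> 0" "a \<noteq> 1" "k \<noteq> 0" "a \<noteq> - s" and s: "s ^ 2 = k"
    and nz: "qpoch q q n \<noteq> 0" "qpoch (k / a) q n \<noteq> 0" "qpoch k q (2 * n) \<noteq> 0" "qpoch (a * q) q (2 * n) \<noteq> 0"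
      "qpoch (a ^ 2 / k * q) q n \<noteq> 0" "qpoch a (q ^ 2) n \<noteq> 0" "qpoch (s * q) q n \<noteq> 0"
  shows "(\<Sum>j\<le>n. qpoch (a ^ 2 / k * q) (q ^ 2) j * qpoch (a / s) q j * qpoch (- (a / s) * q) q j
        / (qpoch (k * q) (q ^ 2) j * qpoch (s * q) q j * qpoch (- s) q j) * vwp_term q a k (a ^ 2 / k) n j)
     = qpoch (a * q) q n * qpoch s q n * qpoch (k ^ 2 / a ^ 2) q n / (qpoch k q n * qpoch (k / a) q n * qpoch (s * q) q n)"
proof -
  define m where "m = a ^ 2 / k"
  define C where "C = k / m"
  define E where "E = k / a"
  define \<rho> where "\<rho> = a / s"
  define w where "w r = qpoch s q n / qpoch (s * q) q n * ((1 + \<rho> * q ^ r) / (1 + \<rho>)) * (C ^ r * qpoch C q (n - r) / qpoch q q (n - r))" for r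
  define \<delta> where "\<delta> j = qpoch (m * q) (q ^ 2) j * qpoch \<rho> q j * qpoch (- \<rho> * q) q j
        / (qpoch (k * q) (q ^ 2) j * qpoch (s * q) q j * qpoch (- s) q j)" for j
  have s0: "s \<noteq> 0" using s ne(4) by (metis zero_power2)
  have m: "m \<noteq> 0" "m = \<rho> ^ 2" using ne by (simp_all add: m_def \<rho>_def power_divide s)
  have E: "E \<noteq> 0" using ne by (simp add: E_def)
  have C: "C = k ^ 2 / a ^ 2" "C = E ^ 2" by (simp_all add: C_def m_def E_def power2_eq_square)
  have rho: "1 + \<rho> \<noteq> 0"
  proof
    assume "1 + \<rho> = 0"
    moreover have "(1 + \<rho>) * s = a + s" using s0 by (simp add: \<rho>_def field_simps)
    ultimately show False using ne(5) by (simp add: eq_neg_iff_add_eq_0)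
  qed
  have eqs: "\<rho> * E = s" "m / a = 1 / E" "\<rho> ^ 2 * E ^ 2 = k" "\<rho> ^ 2 * E = a"
  proof -
    show "\<rho> * E = s" using ne s0 by (simp add: E_def \<rho>_def power2_eq_square flip: s)
    show "m / a = 1 / E" using ne by (simp add: m_def E_def power2_eq_square)
    show "\<rho> ^ 2 * E ^ 2 = k" "\<rho> ^ 2 * E = a"
      unfolding m(2)[symmetric] m_def E_def using ne by (simp_all add: power2_eq_square)
  qed
  have "(\<Sum>j\<le>n. \<delta> j * vwp_term q a k m n j)
    = qpoch q q n * qpoch (a * q) q n / (qpoch k q n * qpoch (k / a) q n) * w 0"
  proof (rule vwp_sum_by_insertion)
    show "qpoch k q n \<noteq> 0" by (rule qpoch_nonzero_mono[OF nz(3)]) simp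
    show "qpoch (m * q) q n \<noteq> 0" using nz by (simp add: m_def)
    fix j assume j: "j \<le> n"
    have jn: "qpoch (a * q) q (n + j) \<noteq> 0" "qpoch k q (2 * j) \<noteq> 0" "qpoch q q (n - j) \<noteq> 0"
      by (rule qpoch_nonzero_mono[OF nz(4)] qpoch_nonzero_mono[OF nz(3)] qpoch_nonzero_mono[OF nz(1)]; use j in simp)+
    have "qpoch k (q ^ 2) n \<noteq> 0" using nz(3) by (auto simp: qpoch_double)
    then have "qpoch s q n \<noteq> 0"
      using qpoch_mult_uminus[of s q n] s by auto
    then have sn: "qpoch s q j \<noteq> 0" "qpoch (s * q ^ j) q (n - j) \<noteq> 0"
      using j qpoch_add[of s q j "n - j"] by auto
    let ?\<sigma> = "\<rho> * q ^ j"
    define X where "X = qpoch s q n / qpoch (s * q) q n / (1 + \<rho>) * (C ^ j * (qpoch m q (2 * j) / qpoch (a * q) q (n + j)))"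
    have "(\<Sum>r=j..n. w r * wp_kernel q a m r j)
      = (\<Sum>t\<le>n-j. X * ((1 + ?\<sigma> * q ^ t) * weighted_term ?\<sigma> E q (n - j) t))"
      unfolding sum_from[OF j]
    proof (rule sum.cong[OF refl])
      fix t assume "t \<in> {..n - j}"
      then have t: "t \<le> n - j" by simp
      have sq: "?\<sigma> ^ 2 = m * q ^ (2 * j)"
        by (simp add: m power_mult_distrib mult.commute flip: power_mult)
      have e: "m * q ^ (2 * j) * E * q = a * q * q ^ (2 * j)"
        by (simp add: m eqs(4)[symmetric] mult_ac)
      show "w (j + t) * wp_kernel q a m (j + t) j = X * ((1 + ?\<sigma> * q ^ t) * weighted_term ?\<sigma> E q (n - j) t)"
        unfolding wp_kernel_shift[OF j t jn(1)] weighted_term_def sq w_def X_def eqs(2) C(2) unfolding e by (simp add: power_add mult_ac)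
    qed
    also have "\<dots> = X * ((1 + ?\<sigma>) * qpoch (k * q ^ (2 * j)) q (n - j) * qpoch (k / a) q (n - j) *
         qpoch (s * q * q ^ j) q (n - j) / (qpoch (s * q ^ j) q (n - j) * qpoch q q (n - j)))"
    proof -
      have e: "?\<sigma> * E = s * q ^ j" "s * q ^ j * q = s * q * q ^ j"
        by (simp_all only: eqs(1)[symmetric] mult_ac)
      have e': "?\<sigma> ^ 2 * E ^ 2 = k * q ^ (2 * j)"
        by (simp add: eqs(3)[symmetric] power_mult_distrib mult.commute flip: power_mult)
      show ?thesis
        unfolding sum_distrib_left[symmetric] weighted_saalschuetz[OF jn(3), of ?\<sigma> E, unfolded e e', OF sn(2) E] E_def[symmetric] ..
    qed
    also have "\<dots> = \<delta> j * (k / m) ^ j * wp_kernel q a k n j"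
    proof -
      have "qpoch s q n = qpoch s q j * qpoch (s * q ^ j) q (n - j)" "qpoch (s * q) q n = qpoch (s * q) q j * qpoch (s * q * q ^ j) q (n - j)"
        using qpoch_add[of _ q j "n - j"] j by simp_all
      then have ratio: "qpoch s q n / qpoch (s * q) q n * qpoch (s * q * q ^ j) q (n - j) / qpoch (s * q ^ j) q (n - j) = qpoch s q j / qpoch (s * q) q j"
        using sn nz(7) by simp
      have delta: "\<delta> j = qpoch s q j / qpoch (s * q) q j * ((1 + ?\<sigma>) / (1 + \<rho>)) * (qpoch m q (2 * j) / qpoch k q (2 * j))"
      proof -
        have "(1 + \<rho>) * qpoch (- \<rho> * q) q j = qpoch (- \<rho>) q j * (1 + ?\<sigma>)"
          using qpoch_Suc[of "- \<rho>" q j] by (simp add: qpoch_Suc_left)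
        then have "qpoch (- \<rho> * q) q j = qpoch (- \<rho>) q j * (1 + ?\<sigma>) / (1 + \<rho>)"
          using rho by (simp add: field_simps)
        moreover have "qpoch m q (2 * j) = qpoch \<rho> q j * qpoch (- \<rho>) q j * qpoch (m * q) (q ^ 2) j"
          unfolding qpoch_double qpoch_mult_uminus m(2) ..
        moreover have "qpoch k q (2 * j) = qpoch s q j * qpoch (- s) q j * qpoch (k * q) (q ^ 2) j"
          unfolding qpoch_double qpoch_mult_uminus s ..
        ultimately show ?thesis
          using sn unfolding \<delta>_def by (simp add: mult_ac)
      qed
      have "X * ((1 + ?\<sigma>) * qpoch (k * q ^ (2 * j)) q (n - j) * qpoch (k / a) q (n - j) *
         qpoch (s * q * q ^ j) q (n - j) / (qpoch (s * q ^ j) q (n - j) * qpoch q q (n - j)))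
        = (qpoch s q n / qpoch (s * q) q n * qpoch (s * q * q ^ j) q (n - j) / qpoch (s * q ^ j) q (n - j))
         * ((1 + ?\<sigma>) / (1 + \<rho>)) * (qpoch m q (2 * j) / qpoch k q (2 * j)) * C ^ j
         * (qpoch k q (2 * j) / qpoch (a * q) q (n + j) *
            (qpoch (k * q ^ (2 * j)) q (n - j) * qpoch (k / a) q (n - j) / qpoch q q (n - j)))"
        unfolding X_def using jn(2) by simp (simp only: mult_ac)
      then show ?thesis
        unfolding ratio delta wp_kernel_split[OF j] C_def .
    qed
    finally show "(\<Sum>r=j..n. w r * wp_kernel q a m r j) = \<delta> j * (k / m) ^ j * wp_kernel q a k n j" .
  qed (use ne m nz in auto)
  then show ?thesis
    using nz rho by (simp add: w_def C(1) \<delta>_def flip: m_def \<rho>_def) (simp add: mult.assoc)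
qed

section \<open>Removing the genericity of a\<close>

lemma isCont_qpoch:
  "isCont f x \<Longrightarrow> isCont (\<lambda>y. qpoch (f y) q n) x"
  unfolding qpoch_def by (intro continuous_intros)

lemma eventually_qpoch_nonzero:
  assumes "isCont f x" and "qpoch (f x) q n \<noteq> 0"
  shows "\<forall>\<^sub>F y in at x. qpoch (f y) q n \<noteq> 0"
  using isCont_qpoch[OF assms(1), of q n] assms(2)
  unfolding isCont_def by (rule tendsto_imp_eventually_ne)

lemma eventually_qpoch_generic:
  assumes "q \<noteq> 0"
  shows "\<forall>\<^sub>F a in at (x :: complex). qpoch (a * q) q n \<noteq> 0"
proof -
  have "\<forall>\<^sub>F a in at x. \<forall>i\<in>{..<n}. a \<noteq> 1 / (q * q ^ i)"
    by (intro eventually_ball_finite ballI eventually_neq_at_within) auto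
  then show ?thesis
  proof eventually_elim
    case (elim a)
    have "a * q * q ^ i \<noteq> 1" if "i < n" for i
    proof
      assume "a * q * q ^ i = 1"
      then have "a = 1 / (q * q ^ i)"
        using assms by (simp add: field_simps)
      then show False using elim that by auto
    qed
    then show ?case by (auto simp: qpoch_def)
  qed
qed

lemma eq_by_continuity:
  fixes f g :: "complex \<Rightarrow> complex"
  assumes "isCont f x" and "isCont g x" and "\<forall>\<^sub>F y in at x. f y = g y"
  shows "f x = g x"
proof -
  have "f \<midarrow>x\<rightarrow> g x"
    using assms(2,3) unfolding isCont_def by (simp add: tendsto_cong)
  with assms(1) show ?thesis
    unfolding isCont_def by (rule LIM_unique)
qed

lemma qpoch_reversed_nonzero:
  assumes "q \<noteq> 0" "a \<noteq> 0" "k \<noteq> 0" and "qpoch (k / a) q n \<noteq> 0" and j: "j \<le> n"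
  shows "qpoch (a * q powi (- int n + 1) / k) q j \<noteq> 0"
proof -
  obtain c where "c \<noteq> 0" and eq: "\<And>y. y \<noteq> 0 \<Longrightarrow>
     qpoch (q powi (1 - int n) / y) q j * qpoch y q (n - j) * y ^ j = c * qpoch y q n"
    using qpoch_reversal[OF assms(1) j] by blast
  then have "qpoch (q powi (1 - int n) / (k / a)) q j \<noteq> 0"
    using eq[of "k / a"] assms by auto
  then show ?thesis by (simp add: mult.commute add.commute)
qed

lemma isCont_vwp_term:
  assumes mu: "isCont \<mu> a" "\<mu> a \<noteq> 0" and ne: "q \<noteq> 0" "a \<noteq> 0" "k \<noteq> 0"
    and nz: "qpoch q q n \<noteq> 0" "qpoch (k / a) q n \<noteq> 0" "qpoch (\<mu> a * q) q n \<noteq> 0" "qpoch a (q ^ 2) n \<noteq> 0"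
      "qpoch (a * q ^ (n + 1)) q n \<noteq> 0"
    and j: "j \<le> n"
  shows "isCont (\<lambda>a. vwp_term q a k (\<mu> a) n j) a"
proof -
  have "qpoch q q j \<noteq> 0" "qpoch (\<mu> a * q) q j \<noteq> 0" "qpoch a (q ^ 2) j \<noteq> 0"
      "qpoch (a * q ^ (n + 1)) q j \<noteq> 0" "qpoch (a * q powi (- int n + 1) / k) q j \<noteq> 0"
    using nz[THEN qpoch_nonzero_mono, OF j] qpoch_reversed_nonzero[OF ne nz(2) j] by blast+
  then show ?thesis
    unfolding vwp_term_def using mu ne
    by (intro continuous_intros isCont_qpoch) auto
qed

text \<open>No denominator of the identity vanishes at \<open>a\<close>, so both sides are continuous there, and the generic
identity applies at all points close to \<open>a\<close> and distinct from it.\<close>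

lemma first_identity:
  assumes ne: "q \<noteq> 0" "a \<noteq> 0" "k \<noteq> 0"
    and nz: "qpoch q q n \<noteq> 0" "qpoch (k / a) q n \<noteq> 0" "qpoch k q (2 * n) \<noteq> 0"
      "qpoch (a ^ 2 * q / k * q) q n \<noteq> 0" "qpoch a (q ^ 2) n \<noteq> 0" "qpoch (a * q ^ (n + 1)) q n \<noteq> 0"
  shows "(\<Sum>j\<le>n. qpoch (a ^ 2 * q / k) q (2 * j) / qpoch k q (2 * j) * vwp_term q a k (a ^ 2 * q / k) n j)
     = qpoch (a * q) q n * qpoch (k ^ 2 / (a ^ 2 * q)) q n / (qpoch k q n * qpoch (k / a) q n)"
proof (rule eq_by_continuity[where x = a and
      f = "\<lambda>a. \<Sum>j\<le>n. qpoch (a ^ 2 * q / k) q (2 * j) / qpoch k q (2 * j) * vwp_term q a k (a ^ 2 * q / k) n j"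
      and g = "\<lambda>a. qpoch (a * q) q n * qpoch (k ^ 2 / (a ^ 2 * q)) q n / (qpoch k q n * qpoch (k / a) q n)"])
  have k2: "qpoch k q (2 * j) \<noteq> 0" if "j \<le> n" for j
    using nz(3) by (rule qpoch_nonzero_mono) (use that in simp)
  have kn: "qpoch k q n \<noteq> 0"
    using nz(3) by (rule qpoch_nonzero_mono) simp
  have mu: "isCont (\<lambda>a. a ^ 2 * q / k) a"
    using ne by (intro continuous_intros) auto
  show "isCont (\<lambda>a. \<Sum>j\<le>n. qpoch (a ^ 2 * q / k) q (2 * j) / qpoch k q (2 * j) * vwp_term q a k (a ^ 2 * q / k) n j) a"
    by (intro continuous_intros isCont_qpoch isCont_vwp_term mu) (use ne nz k2 in auto)
  show "isCont (\<lambda>a. qpoch (a * q) q n * qpoch (k ^ 2 / (a ^ 2 * q)) q n / (qpoch k q n * qpoch (k / a) q n)) a"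
    by (intro continuous_intros isCont_qpoch) (use ne nz kn in auto)
  have "\<forall>\<^sub>F a in at a. qpoch (k / a) q n \<noteq> 0" "\<forall>\<^sub>F a in at a. qpoch (a ^ 2 * q / k * q) q n \<noteq> 0"
    "\<forall>\<^sub>F a in at a. qpoch a (q ^ 2) n \<noteq> 0"
    by (intro eventually_qpoch_nonzero continuous_intros nz; use ne in simp)+
  moreover have "\<forall>\<^sub>F a in at a. qpoch (a * q) q (2 * n) \<noteq> 0"
    using ne(1) by (rule eventually_qpoch_generic)
  moreover have "\<forall>\<^sub>F b in at a. b \<noteq> 1" "\<forall>\<^sub>F b in at a. b \<noteq> 0"
    by (rule eventually_neq_at_within)+
  ultimately show "\<forall>\<^sub>F a in at a. (\<Sum>j\<le>n. qpoch (a ^ 2 * q / k) q (2 * j) / qpoch k q (2 * j) * vwp_term q a k (a ^ 2 * q / k) n j)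
     = qpoch (a * q) q n * qpoch (k ^ 2 / (a ^ 2 * q)) q n / (qpoch k q n * qpoch (k / a) q n)"
    by eventually_elim (rule first_identity_generic, use ne nz in auto)
qed

lemma second_identity:
  assumes ne: "q \<noteq> 0" "a \<noteq> 0" "k \<noteq> 0" and s: "s ^ 2 = k"
    and nz: "qpoch q q n \<noteq> 0" "qpoch (k / a) q n \<noteq> 0" "qpoch k q (2 * n) \<noteq> 0"
      "qpoch (a ^ 2 / k * q) q n \<noteq> 0" "qpoch a (q ^ 2) n \<noteq> 0" "qpoch (a * q ^ (n + 1)) q n \<noteq> 0"
      "qpoch (s * q) q n \<noteq> 0"
  shows "(\<Sum>j\<le>n. qpoch (a ^ 2 / k * q) (q ^ 2) j * qpoch (a / s) q j * qpoch (- (a / s) * q) q j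
        / (qpoch (k * q) (q ^ 2) j * qpoch (s * q) q j * qpoch (- s) q j) * vwp_term q a k (a ^ 2 / k) n j)
     = qpoch (a * q) q n * qpoch s q n * qpoch (k ^ 2 / a ^ 2) q n / (qpoch k q n * qpoch (k / a) q n * qpoch (s * q) q n)"
  (is "?F a = ?G a")
proof (rule eq_by_continuity[where x = a and f = ?F and g = ?G])
  have s0: "s \<noteq> 0" using s ne by (metis zero_power2)
  have k2: "qpoch (k * q) (q ^ 2) j \<noteq> 0" "qpoch (- s) q j \<noteq> 0" "qpoch (s * q) q j \<noteq> 0" if "j \<le> n" for j
  proof -
    have "qpoch k q (2 * j) \<noteq> 0"
      using nz(3) by (rule qpoch_nonzero_mono) (use that in simp)
    then show "qpoch (k * q) (q ^ 2) j \<noteq> 0" "qpoch (- s) q j \<noteq> 0"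
      using qpoch_mult_uminus[of s q j] s by (auto simp: qpoch_double)
    show "qpoch (s * q) q j \<noteq> 0" using nz(7) that by (rule qpoch_nonzero_mono)
  qed
  have kn: "qpoch k q n \<noteq> 0"
    using nz(3) by (rule qpoch_nonzero_mono) simp
  have mu: "isCont (\<lambda>a. a ^ 2 / k) a"
    using ne by (intro continuous_intros) auto
  show "isCont ?F a"
    by (intro continuous_intros isCont_qpoch isCont_vwp_term mu) (use ne nz k2 s0 in auto)
  show "isCont ?G a"
    by (intro continuous_intros isCont_qpoch) (use ne nz kn in auto)
  have "\<forall>\<^sub>F a in at a. qpoch (k / a) q n \<noteq> 0" "\<forall>\<^sub>F a in at a. qpoch (a ^ 2 / k * q) q n \<noteq> 0"
    "\<forall>\<^sub>F a in at a. qpoch a (q ^ 2) n \<noteq> 0"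
    by (intro eventually_qpoch_nonzero continuous_intros nz; use ne in simp)+
  moreover have "\<forall>\<^sub>F a in at a. qpoch (a * q) q (2 * n) \<noteq> 0"
    using ne(1) by (rule eventually_qpoch_generic)
  moreover have "\<forall>\<^sub>F b in at a. b \<noteq> 1" "\<forall>\<^sub>F b in at a. b \<noteq> 0" "\<forall>\<^sub>F b in at a. b \<noteq> - s"
    by (rule eventually_neq_at_within)+
  ultimately show "\<forall>\<^sub>F a in at a. ?F a = ?G a"
    by eventually_elim (rule second_identity_generic, use ne nz s in auto)
qed

section \<open>The two summations\<close>

theorem theorem1p9:
  fixes n :: nat and q a k sqrt_a sqrt_k sqrt_q :: complex
  assumes "q \<noteq> 0" and "a \<noteq> 0" and "k \<noteq> 0"
    and "sqrt_a ^ 2 = a" and "sqrt_k ^ 2 = k" and "sqrt_q ^ 2 = q"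
  shows
    "(let sqrt_kq = sqrt_k * sqrt_q;
          sqrt_q_k = sqrt_q / sqrt_k;
          xs = [a, q * sqrt_a, - q * sqrt_a, a * sqrt_q_k, - a * sqrt_q_k,
                a * q / sqrt_k, - a * q / sqrt_k, k / (a * q), k * q ^ n, q powi (- int n)];
          ys = [sqrt_a, - sqrt_a, sqrt_kq, - sqrt_kq,
                sqrt_k, - sqrt_k, a ^ 2 * q ^ 2 / k, a * q powi (- int n + 1) / k, a * q ^ (n + 1)]
      in qhyp_denominators_nonzero n ys q \<longrightarrow> qpochs [k, k / a] q n \<noteq> 0 \<longrightarrow>
         qhyp_terminating n xs ys q q
           = qpochs [a * q, k ^ 2 / (a ^ 2 * q)] q n / qpochs [k, k / a] q n)
     \<and>
     (let sqrt_kq = sqrt_k * sqrt_q;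
          sqrt_q_k = sqrt_q / sqrt_k;
          xs = [a, q * sqrt_a, - q * sqrt_a, a * sqrt_q_k, - a * sqrt_q_k,
                a / sqrt_k, - a * q / sqrt_k, k / a, k * q ^ n, q powi (- int n)];
          ys = [sqrt_a, - sqrt_a, sqrt_kq, - sqrt_kq,
                q * sqrt_k, - sqrt_k, a ^ 2 * q / k, a * q powi (- int n + 1) / k, a * q ^ (n + 1)]
      in qhyp_denominators_nonzero n ys q \<longrightarrow> qpochs [k, k / a, q * sqrt_k] q n \<noteq> 0 \<longrightarrow>
         qhyp_terminating n xs ys q q
           = qpochs [a * q, sqrt_k, k ^ 2 / a ^ 2] q n / qpochs [k, k / a, q * sqrt_k] q n)"
proof -
  \<comment> \<open>The parameters \<open>x, -x\<close> combine to base \<open>q\<^sup>2\<close>, which removes the square roots.\<close>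
  have pairs: "qpoch (q * sqrt_a) q j * qpoch (- q * sqrt_a) q j = qpoch (a * q ^ 2) (q ^ 2) j"
    "qpoch sqrt_a q j * qpoch (- sqrt_a) q j = qpoch a (q ^ 2) j"
    "qpoch (a * (sqrt_q / sqrt_k)) q j * qpoch (- a * (sqrt_q / sqrt_k)) q j = qpoch (a ^ 2 * q / k) (q ^ 2) j"
    "qpoch (sqrt_k * sqrt_q) q j * qpoch (- (sqrt_k * sqrt_q)) q j = qpoch (k * q) (q ^ 2) j"
    "qpoch (a * q / sqrt_k) q j * qpoch (- a * q / sqrt_k) q j = qpoch (a ^ 2 * q / k * q) (q ^ 2) j"
    "qpoch sqrt_k q j * qpoch (- sqrt_k) q j = qpoch k (q ^ 2) j" for j
    using qpoch_mult_uminus[of "q * sqrt_a" q j] qpoch_mult_uminus[of "sqrt_a" q j]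
      qpoch_mult_uminus[of "a * (sqrt_q / sqrt_k)" q j] qpoch_mult_uminus[of "sqrt_k * sqrt_q" q j]
      qpoch_mult_uminus[of "a * q / sqrt_k" q j] qpoch_mult_uminus[of "sqrt_k" q j]
    by (simp_all add: power_mult_distrib power_divide assms(4-6) mult_ac) (simp_all add: power2_eq_square mult_ac)
  have 1: "qhyp_terminating n xs ys q q = qpochs [a * q, k ^ 2 / (a ^ 2 * q)] q n / qpochs [k, k / a] q n"
    if xs: "xs = [a, q * sqrt_a, - q * sqrt_a, a * (sqrt_q / sqrt_k), - a * (sqrt_q / sqrt_k),
                a * q / sqrt_k, - a * q / sqrt_k, k / (a * q), k * q ^ n, q powi (- int n)]"
      and ys: "ys = [sqrt_a, - sqrt_a, sqrt_k * sqrt_q, - (sqrt_k * sqrt_q),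
                sqrt_k, - sqrt_k, a ^ 2 * q ^ 2 / k, a * q powi (- int n + 1) / k, a * q ^ (n + 1)]"
      and den: "qhyp_denominators_nonzero n ys q" and rhs: "qpochs [k, k / a] q n \<noteq> 0" for xs ys
  proof -
    let ?m = "a ^ 2 * q / k"
    have m: "a / ?m = k / (a * q)" "?m * q = a ^ 2 * q ^ 2 / k"
      using assms(1-3) by (simp_all add: power2_eq_square)
    have "qpochs (q # ys) q n \<noteq> 0" using den by (auto simp: qhyp_denominators_nonzero_def)
    then have nz: "qpoch q q n \<noteq> 0" "qpoch sqrt_a q n * qpoch (- sqrt_a) q n \<noteq> 0"
      "qpoch sqrt_k q n * qpoch (- sqrt_k) q n * (qpoch (sqrt_k * sqrt_q) q n * qpoch (- (sqrt_k * sqrt_q)) q n) \<noteq> 0"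
      "qpoch (a ^ 2 * q ^ 2 / k) q n \<noteq> 0" "qpoch (a * q ^ (n + 1)) q n \<noteq> 0"
      by (simp_all add: ys qpochs_def)
    have coeff: "qhyp_coeff xs ys q j * q ^ j = qpoch ?m q (2 * j) / qpoch k q (2 * j) * vwp_term q a k ?m n j" for j
      unfolding qpoch_double vwp_term_def pairs[symmetric] unfolding m
      by (simp add: xs ys qhyp_coeff_def qpochs_def mult_ac)
    show ?thesis
      unfolding qhyp_terminating_def coeff
      by (subst first_identity) (use assms nz rhs in \<open>simp_all only: pairs qpoch_double m, simp_all add: qpochs_def\<close>)
  qed
  have 2: "qhyp_terminating n xs ys q q = qpochs [a * q, sqrt_k, k ^ 2 / a ^ 2] q n / qpochs [k, k / a, q * sqrt_k] q n"
    if xs: "xs = [a, q * sqrt_a, - q * sqrt_a, a * (sqrt_q / sqrt_k), - a * (sqrt_q / sqrt_k),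
                a / sqrt_k, - a * q / sqrt_k, k / a, k * q ^ n, q powi (- int n)]"
      and ys: "ys = [sqrt_a, - sqrt_a, sqrt_k * sqrt_q, - (sqrt_k * sqrt_q),
                q * sqrt_k, - sqrt_k, a ^ 2 * q / k, a * q powi (- int n + 1) / k, a * q ^ (n + 1)]"
      and den: "qhyp_denominators_nonzero n ys q" and rhs: "qpochs [k, k / a, q * sqrt_k] q n \<noteq> 0" for xs ys
  proof -
    let ?m = "a ^ 2 / k"
    have m: "a / ?m = k / a" "?m * q = a ^ 2 * q / k" "- (a / sqrt_k) * q = - a * q / sqrt_k" "sqrt_k * q = q * sqrt_k"
      using assms(1-3) by (simp_all add: power2_eq_square)
    have "qpochs (q # ys) q n \<noteq> 0" using den by (auto simp: qhyp_denominators_nonzero_def)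
    then have nz0: "qpoch q q n \<noteq> 0" "qpoch sqrt_a q n * qpoch (- sqrt_a) q n \<noteq> 0"
      "qpoch (sqrt_k * sqrt_q) q n * qpoch (- (sqrt_k * sqrt_q)) q n \<noteq> 0" "qpoch (- sqrt_k) q n \<noteq> 0"
      "qpoch (q * sqrt_k) q n \<noteq> 0"
      "qpoch (a ^ 2 * q / k) q n \<noteq> 0" "qpoch (a * q ^ (n + 1)) q n \<noteq> 0"
      by (simp_all add: ys qpochs_def)
    \<comment> \<open>The series has \<open>(q\<surd>k)\<^sub>j\<close> below the line but not \<open>(\<surd>k)\<^sub>j\<close>; the missing factor \<open>1 - \<surd>k\<close> is
      supplied by \<open>(k)\<^sub>n\<close> on the right-hand side.\<close>
    have "qpoch k (q ^ 2) n \<noteq> 0"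
    proof (cases n)
      case (Suc l)
      have "qpoch sqrt_k q n \<noteq> 0"
      proof -
        have "qpoch k q (Suc l) \<noteq> 0" using rhs by (simp add: qpochs_def Suc)
        then have "k \<noteq> 1" by (auto simp: qpoch_Suc_left)
        then have "sqrt_k \<noteq> 1" using assms(5) by auto
        moreover have "qpoch (sqrt_k * q) q l \<noteq> 0"
          using nz0(5)[unfolded mult.commute[of q sqrt_k]] by (rule qpoch_nonzero_mono) (simp add: Suc)
        ultimately show ?thesis by (simp add: Suc qpoch_Suc_left)
      qed
      then show ?thesis using nz0(4) by (simp flip: pairs)
    qed simp
    with nz0 have nz: "qpoch k q (2 * n) \<noteq> 0" "qpoch a (q ^ 2) n \<noteq> 0"
      by (simp_all add: qpoch_double pairs)
    have coeff: "qhyp_coeff xs ys q j * q ^ j =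
        qpoch (?m * q) (q ^ 2) j * qpoch (a / sqrt_k) q j * qpoch (- (a / sqrt_k) * q) q j
        / (qpoch (k * q) (q ^ 2) j * qpoch (sqrt_k * q) q j * qpoch (- sqrt_k) q j) * vwp_term q a k ?m n j" for j
      unfolding vwp_term_def m pairs[symmetric]
      by (simp add: xs ys qhyp_coeff_def qpochs_def mult_ac)
    show ?thesis
      unfolding qhyp_terminating_def coeff
      by (subst second_identity) (use assms nz nz0 rhs in \<open>simp_all only: m, simp_all add: qpochs_def mult.assoc\<close>)
  qed
  show ?thesis
    unfolding Let_def using 1[OF refl refl] 2[OF refl refl] by blast
qed

end
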